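(* Let $n\ge 1$ and let $F(\alpha,\beta)$, with $\alpha=(\alpha_1,\dots,\alpha_n)\in\mathbb{R}^n$ and $\beta=(\beta_1,\dots,\beta_n)\in\mathbb{R}^n$, be a (symmetric-)matrix-valued multi-homogeneous polynomial of degree vector $d\in\mathbb{N}^n$. If $F(\alpha,\beta)>0$ (positive definite) for all $(\alpha,\beta)$ such that $(\alpha_i,\beta_i)\in\Delta^2$ for $i=1,\dots,n$, then there exists an integer $e\ge 0$ such that all the coefficients of $$\left(\prod_{i=1}^n(\alpha_i+\beta_i)^e\right)F(\alpha,\beta)$$ are positive definite.
   Context: $\mathbb{N}$ denotes the non-negative integers. $\Delta^2:=\{(a,b)\in\mathbb{R}^2: a+b=1,\ a\ge 0,\ b\ge 0\}$ is the standard unit simplex. A matrix-valued multi-homogeneous polynomial of degree vector $d=(d_1,\dots,d_n)\in\mathbb{N}^n$ is a polynomial of the form $$F(\alpha,\beta)=\sum_{h,g\in\mathbb{N}^n,\ h+g=d}F_{h,g}\,\alpha_1^{h_1}\beta_1^{g_1}\cdots\alpha_n^{h_n}\beta_n^{g_n},$$ with real symmetric matrix coefficients $F_{h,g}$ of a fixed size. The product $\left(\prod_{i=1}^n(\alpha_i+\beta_i)^e\right)F(\alpha,\beta)$ is multi-homogeneous of degree vector $(d_1+e,\dots,d_n+e)$. "All the coefficients" means the coefficients of all the monomials $\alpha_1^{h_1}\beta_1^{g_1}\cdots\alpha_n^{h_n}\beta_n^{g_n}$ with $h,g\in\mathbb{N}^n$ and $h_i+g_i=d_i+e$ for all $i$.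 *)

theory Defs
  imports "HOL-Analysis.Analysis" "HOL-Library.Poly_Mapping"
begin

text \<open>
  A real polynomial in \<open>\<alpha>\<^sub>i, \<beta>\<^sub>i\<close>, \<open>i :: 'n\<close>, is a finitely supported family of coefficients; the
  exponent pair \<open>(h, g)\<close> stands for the monomial \<open>\<Prod>\<^sub>i \<alpha>\<^sub>i ^ h\<^sub>i * \<beta>\<^sub>i ^ g\<^sub>i\<close>. Polynomial multiplication
  is the convolution product of \<^theory>\<open>HOL-Library.Poly_Mapping\<close>. A matrix-valued polynomial is a
  matrix of polynomials; its coefficients and values are taken entrywise.
\<close>

type_synonym 'n expo = "(nat ^ 'n) \<times> (nat ^ 'n)"

type_synonym 'n bipoly = "'n expo \<Rightarrow>\<^sub>0 real"

type_synonym ('n, 'm) matpoly = "'n bipoly ^ 'm ^ 'm"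

definition alpha_var :: "'n::finite \<Rightarrow> 'n bipoly" where
  "alpha_var i = Poly_Mapping.single (axis i 1, 0) 1"

definition beta_var :: "'n::finite \<Rightarrow> 'n bipoly" where
  "beta_var i = Poly_Mapping.single (0, axis i 1) 1"

definition eval_bipoly :: "'n::finite bipoly \<Rightarrow> real ^ 'n \<Rightarrow> real ^ 'n \<Rightarrow> real" where
  "eval_bipoly p \<alpha> \<beta> =
     (\<Sum>(h, g) \<in> Poly_Mapping.keys p.
        Poly_Mapping.lookup p (h, g) * (\<Prod>i\<in>UNIV. (\<alpha> $ i) ^ (h $ i) * (\<beta> $ i) ^ (g $ i)))"

definition mat_coeff :: "('n::finite, 'm::finite) matpoly \<Rightarrow> nat ^ 'n \<Rightarrow> nat ^ 'n \<Rightarrow> real ^ 'm ^ 'm" where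
  "mat_coeff F h g = map_matrix (\<lambda>p. Poly_Mapping.lookup p (h, g)) F"

definition eval_matpoly ::
  "('n::finite, 'm::finite) matpoly \<Rightarrow> real ^ 'n \<Rightarrow> real ^ 'n \<Rightarrow> real ^ 'm ^ 'm" where
  "eval_matpoly F \<alpha> \<beta> = map_matrix (\<lambda>p. eval_bipoly p \<alpha> \<beta>) F"

definition smult_matpoly ::
  "'n::finite bipoly \<Rightarrow> ('n, 'm::finite) matpoly \<Rightarrow> ('n, 'm) matpoly" where
  "smult_matpoly q F = map_matrix (\<lambda>p. q * p) F"

definition symmetric_mat :: "real ^ 'm ^ 'm \<Rightarrow> bool" where
  "symmetric_mat A \<longleftrightarrow> transpose A = A"

definition pos_def :: "real ^ 'm::finite ^ 'm \<Rightarrow> bool" where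
  "pos_def A \<longleftrightarrow> symmetric_mat A \<and> (\<forall>x. x \<noteq> 0 \<longrightarrow> 0 < x \<bullet> (A *v x))"

definition multi_homogeneous :: "nat ^ 'n \<Rightarrow> ('n::finite, 'm::finite) matpoly \<Rightarrow> bool" where
  "multi_homogeneous d F \<longleftrightarrow>
     (\<forall>h g. symmetric_mat (mat_coeff F h g)) \<and>
     (\<forall>h g. mat_coeff F h g \<noteq> 0 \<longrightarrow> h + g = d)"

definition unit_simplex2 :: "(real \<times> real) set" where
  "unit_simplex2 = {(a, b). a + b = 1 \<and> a \<ge> 0 \<and> b \<ge> 0}"

lemma finite_expo_sum: "finite {(h :: nat ^ 'n::finite, g). h + g = d}"
proof -
  have fin: "finite {h :: nat ^ 'n. \<forall>i. h $ i \<in> {..d $ i}}" (is "finite ?S")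
  proof (rule finite_subset)
    show "?S \<subseteq> vec_lambda ` (Pi\<^sub>E UNIV (\<lambda>i. {..d $ i}))"
    proof
      fix h assume "h \<in> ?S"
      then show "h \<in> vec_lambda ` (Pi\<^sub>E UNIV (\<lambda>i. {..d $ i}))"
        by (intro image_eqI[where x = "vec_nth h"]) auto
    qed
    show "finite (vec_lambda ` (Pi\<^sub>E UNIV (\<lambda>i. {..d $ i})) :: (nat ^ 'n) set)"
      by (intro finite_imageI finite_PiE) auto
  qed
  show ?thesis
    by (rule finite_subset[OF _ finite_cartesian_product[OF fin fin]]) auto
qed

lemma eval_matpoly_multi_homogeneous:
  assumes "multi_homogeneous d F"
  shows "eval_matpoly F \<alpha> \<beta> =
    (\<Sum>(h, g) \<in> {(h, g). h + g = d}.
       (\<Prod>i\<in>UNIV. (\<alpha> $ i) ^ (h $ i) * (\<beta> $ i) ^ (g $ i)) *\<^sub>R mat_coeff F h g)"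
proof -
  have "eval_bipoly (F $ j $ k) \<alpha> \<beta> =
    (\<Sum>(h, g) \<in> {(h, g). h + g = d}.
       (\<Prod>i\<in>UNIV. (\<alpha> $ i) ^ (h $ i) * (\<beta> $ i) ^ (g $ i)) * mat_coeff F h g $ j $ k)" for j k
    unfolding eval_bipoly_def
  proof (rule sum.mono_neutral_cong_left[OF finite_expo_sum])
    show "Poly_Mapping.keys (F $ j $ k) \<subseteq> {(h, g). h + g = d}"
    proof clarify
      fix h g assume "(h, g) \<in> Poly_Mapping.keys (F $ j $ k)"
      then have "mat_coeff F h g $ j $ k \<noteq> 0"
        by (simp add: mat_coeff_def map_matrix_def in_keys_iff)
      then have "mat_coeff F h g \<noteq> 0" by auto
      then show "h + g = d" using assms by (auto simp: multi_homogeneous_def)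
    qed
  qed (auto simp: mat_coeff_def map_matrix_def in_keys_iff)
  then show ?thesis
    by (simp add: vec_eq_iff eval_matpoly_def map_matrix_def case_prod_beta)
qed

end

theory Submission
  imports Defs
begin

text \<open>
  The argument is that of Polya's theorem, with one degree of homogeneity per pair of variables and
  matrices as coefficients. The coefficient of \<open>\<alpha>\<^sup>h \<beta>\<^sup>g\<close> in the product is the sum of the matrices
  \<open>F\<^bsub>a,b\<^esub>\<close>, weighted by the products over \<open>i\<close> of the binomial coefficients \<open>e choose (h\<^sub>i - a\<^sub>i)\<close>. Since
  \<open>h\<^sub>i + g\<^sub>i = a\<^sub>i + b\<^sub>i + e\<close>, such a binomial coefficient is \<open>e! / (h\<^sub>i! g\<^sub>i!)\<close>, which does not depend on
  \<open>(a, b)\<close>, times the product of the falling factorials of \<open>h\<^sub>i\<close> of length \<open>a\<^sub>i\<close> and of \<open>g\<^sub>i\<close> of length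
  \<open>b\<^sub>i\<close> (\<open>binomial_eq_falling_powers\<close>). Up to a positive factor, the coefficient is therefore the value
  at \<open>(h, g)\<close> of \<open>F\<close> with every power replaced by a falling factorial (\<open>mat_coeff_product\<close>).

  Dividing the \<open>i\<close>-th variables by \<open>N\<^sub>i = d\<^sub>i + e\<close> moves the point \<open>(h\<^sub>i, g\<^sub>i)\<close> into the simplex and turns
  the falling factorials into products \<open>x (x - s) (x - 2 s) \<dots>\<close> with step \<open>s = 1 / N\<^sub>i\<close>
  (\<open>falling_eval_scale\<close>). At step \<open>0\<close> these products are ordinary powers, and the value is \<open>F\<close> on the
  simplices, which is positive definite by hypothesis. The value depends continuously on the point,
  the step and the vector to which the quadratic form is applied, and points and unit vectors range
  over compact sets, so positive definiteness persists for all sufficiently small steps, uniformly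
  in the point (\<open>falling_eval_pos_def_small_step\<close>). A large \<open>e\<close> makes all steps small.
\<close>

section \<open>Falling powers\<close>

text \<open>
  The step \<open>s\<close> interpolates between the power \<open>x ^ k\<close> at \<open>s = 0\<close> and the falling factorial at
  \<open>s = 1\<close>.
\<close>

definition falling_power :: "real \<Rightarrow> real \<Rightarrow> nat \<Rightarrow> real" where
  "falling_power s x k = (\<Prod>j<k. x - real j * s)"

lemma falling_power_step_zero: "falling_power 0 x k = x ^ k"
  by (simp add: falling_power_def)

lemma falling_power_scale: "falling_power (t * s) (t * x) k = t ^ k * falling_power s x k"
proof -
  have "(\<Prod>j<k. t * x - real j * (t * s)) = (\<Prod>j<k. t * (x - real j * s))"
    by (simp add: algebra_simps)
  then show ?thesis
    by (simp add: falling_power_def prod.distrib)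
qed

lemma falling_power_nat:
  "falling_power 1 (real n) k = (if k \<le> n then fact n / fact (n - k) else 0)"
proof (induction k)
  case 0
  then show ?case by (simp add: falling_power_def)
next
  case (Suc k)
  have step: "falling_power 1 (real n) (Suc k) = falling_power 1 (real n) k * (real n - real k)"
    by (simp add: falling_power_def)
  show ?case
  proof (cases "Suc k \<le> n")
    case True
    then have "n - k = Suc (n - Suc k)" by simp
    then have "(fact (n - k) :: real) = (real n - real k) * fact (n - Suc k)"
      using True by (simp add: of_nat_diff)
    with True show ?thesis
      unfolding step Suc.IH by (simp add: divide_simps)
  next
    case False
    then show ?thesis unfolding step Suc.IH by (cases "k = n") auto
  qed
qed

text \<open>
  The shifts \<open>a\<close>, \<open>b\<close> enter the right-hand side only through a product of a function of \<open>a\<close> and one of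
  \<open>b\<close>, each a deformed power. The case distinction on the left is absorbed because a falling factorial
  of \<open>h\<close> of length greater than \<open>h\<close> has a factor \<open>0\<close>.
\<close>

lemma binomial_eq_falling_powers:
  assumes "h + g = a + b + e"
  shows "(if a \<le> h \<and> b \<le> g then real (e choose (h - a)) else 0) =
    fact e / (fact h * fact g) * (falling_power 1 (real h) a * falling_power 1 (real g) b)"
proof (cases "a \<le> h \<and> b \<le> g")
  case True
  then have "h - a \<le> e" and "e - (h - a) = g - b" using assms by auto
  then have "real (e choose (h - a)) = fact e / (fact (h - a) * fact (g - b))"
    by (simp add: binomial_fact)
  with True show ?thesis by (simp add: falling_power_nat)
qed (auto simp: falling_power_nat)

section \<open>Coefficients of the product\<close>

lemma prod_single:
  "finite A \<Longrightarrow> (\<Prod>i\<in>A. Poly_Mapping.single (f i) (c i)) =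
     Poly_Mapping.single (\<Sum>i\<in>A. f i) (\<Prod>i\<in>A. c i :: 'b::comm_semiring_1)"
  by (induction A rule: finite_induct) (simp_all add: mult_single)

lemma power_single:
  "Poly_Mapping.single v c ^ k = Poly_Mapping.single ((\<Sum>i<k. v)) (c ^ k :: 'b::comm_semiring_1)"
  using prod_single[of "{..<k}" "\<lambda>_. v" "\<lambda>_. c"] by simp

lemma sum_axis: "(\<Sum>i\<in>UNIV. axis i (f i)) = ((\<chi> i. f i) :: ('b::comm_monoid_add) ^ 'n::finite)"
  by (simp add: vec_eq_iff axis_def if_distrib sum.delta' cong: if_cong)

lemma sum_Pair: "(\<Sum>i\<in>A. (f i, g i)) = (\<Sum>i\<in>A. f i, \<Sum>i\<in>A. g i)"
  by (induction A rule: infinite_finite_induct) (auto simp: zero_prod_def)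

lemma sum_const_axis: "(\<Sum>j<k. axis i (1::nat)) = axis i k"
  by (induction k) (auto simp: vec_eq_iff axis_def)

lemma alpha_var_power: "alpha_var i ^ k = Poly_Mapping.single (axis i k, 0) 1"
  by (simp add: alpha_var_def power_single sum_Pair sum_const_axis del: sum_constant One_nat_def)

lemma beta_var_power: "beta_var i ^ k = Poly_Mapping.single (0, axis i k) 1"
  by (simp add: beta_var_def power_single sum_Pair sum_const_axis del: sum_constant One_nat_def)

lemma of_nat_times_single:
  "of_nat m * Poly_Mapping.single v c = Poly_Mapping.single v (of_nat m * c :: real)"
  by (induction m) (simp_all add: algebra_simps single_add)

lemma alpha_plus_beta_power:
  "(alpha_var i + beta_var i) ^ e =
     (\<Sum>k\<le>e. Poly_Mapping.single (axis i k, axis i (e - k)) (real (e choose k)))"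
  by (simp add: binomial_ring alpha_var_power beta_var_power mult_single mult.assoc
      of_nat_times_single)

lemma prod_alpha_plus_beta_power:
  "(\<Prod>i\<in>UNIV. (alpha_var i + beta_var i) ^ e :: 'n::finite bipoly) =
     (\<Sum>k\<in>Pi\<^sub>E UNIV (\<lambda>_. {..e}).
        Poly_Mapping.single (\<chi> i. k i, \<chi> i. e - k i) (\<Prod>i\<in>UNIV. real (e choose k i)))"
  by (simp add: alpha_plus_beta_power prod_sum_PiE prod_single sum_Pair sum_axis)

lemma poly_mapping_eq_sum_single:
  assumes "finite D" "Poly_Mapping.keys p \<subseteq> D"
  shows "p = (\<Sum>v\<in>D. Poly_Mapping.single v (Poly_Mapping.lookup p v))"
proof (rule poly_mapping_eqI)
  fix w
  have "w \<notin> D \<Longrightarrow> Poly_Mapping.lookup p w = 0"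
    using assms(2) by (meson in_keys_iff subsetD)
  then show "Poly_Mapping.lookup p w =
      Poly_Mapping.lookup (\<Sum>v\<in>D. Poly_Mapping.single v (Poly_Mapping.lookup p v)) w"
    using assms(1) by (simp add: lookup_sum lookup_single when_def sum.delta)
qed

text \<open>
  For each monomial \<open>(a, b)\<close> of \<open>p\<close>, at most one monomial \<open>(k, e - k)\<close> of the multiplier
  contributes to \<open>(h, g)\<close>, namely the one with \<open>k = h - a\<close>. The assumption on \<open>h + g\<close> makes the two
  conditions on \<open>k\<close>, from the \<open>\<alpha>\<close> and from the \<open>\<beta>\<close> exponents, compatible.
\<close>

lemma lookup_prod_times:
  fixes p :: "'n::finite bipoly"
  assumes keys: "Poly_Mapping.keys p \<subseteq> {(a, b). a + b = d}"
    and hg: "\<And>i. h $ i + g $ i = d $ i + e"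
  shows "Poly_Mapping.lookup ((\<Prod>i\<in>UNIV. (alpha_var i + beta_var i) ^ e) * p) (h, g) =
    (\<Sum>(a, b) \<in> {(a, b). a + b = d}.
       (\<Prod>i\<in>UNIV. if a $ i \<le> h $ i \<and> b $ i \<le> g $ i then real (e choose (h $ i - a $ i)) else 0)
         * Poly_Mapping.lookup p (a, b))"
proof -
  let ?D = "{(a, b). a + b = d}"
  let ?K = "Pi\<^sub>E UNIV (\<lambda>_. {..e}) :: ('n \<Rightarrow> nat) set"
  let ?B = "\<lambda>k. \<Prod>i\<in>UNIV. real (e choose k i)"
  have p: "p = (\<Sum>v\<in>?D. Poly_Mapping.single v (Poly_Mapping.lookup p v))"
    by (rule poly_mapping_eq_sum_single[OF finite_expo_sum keys])
  have "Poly_Mapping.lookup ((\<Prod>i\<in>UNIV. (alpha_var i + beta_var i) ^ e) * p) (h, g) =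
     Poly_Mapping.lookup ((\<Prod>i\<in>UNIV. (alpha_var i + beta_var i) ^ e) *
       (\<Sum>v\<in>?D. Poly_Mapping.single v (Poly_Mapping.lookup p v))) (h, g)"
    using p by simp
  also have "\<dots> = (\<Sum>v\<in>?D. \<Sum>k\<in>?K.
      (?B k * Poly_Mapping.lookup p v when ((\<chi> i. k i, \<chi> i. e - k i) + v = (h, g))))"
    by (subst sum.swap)
       (simp add: prod_alpha_plus_beta_power sum_product mult_single lookup_sum lookup_single)
  also have "\<dots> = (\<Sum>v\<in>?D.
       (\<Prod>i\<in>UNIV. if fst v $ i \<le> h $ i \<and> snd v $ i \<le> g $ i
          then real (e choose (h $ i - fst v $ i)) else 0) * Poly_Mapping.lookup p v)"
  proof (rule sum.cong[OF refl])
    fix v assume "v \<in> ?D"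
    then obtain a b where v: "v = (a, b)" and ab: "a + b = d" by auto
    have d: "d $ i = a $ i + b $ i" for i using ab by auto
    show "(\<Sum>k\<in>?K. (?B k * Poly_Mapping.lookup p v when
          ((\<chi> i. k i, \<chi> i. e - k i) + v = (h, g)))) =
       (\<Prod>i\<in>UNIV. if fst v $ i \<le> h $ i \<and> snd v $ i \<le> g $ i
          then real (e choose (h $ i - fst v $ i)) else 0) * Poly_Mapping.lookup p v"
    proof (cases "\<forall>i. a $ i \<le> h $ i \<and> b $ i \<le> g $ i")
      case True
      have inK: "(\<lambda>i. h $ i - a $ i) \<in> ?K"
      proof -
        have "h $ i - a $ i \<le> e" for i
          using hg[of i] d[of i] spec[OF True, of i] by linarith
        then show ?thesis by auto
      qed
      \<comment> \<open>On natural numbers \<open>e - k i\<close> is truncated; \<open>k \<in> ?K\<close> makes it a true difference.\<close>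
      have iff: "(\<chi> i. k i, \<chi> i. e - k i) + v = (h, g) \<longleftrightarrow> k = (\<lambda>i. h $ i - a $ i)"
        if "k \<in> ?K" for k
      proof -
        have "k i + a $ i = h $ i \<and> (e - k i) + b $ i = g $ i \<longleftrightarrow> k i = h $ i - a $ i" for i
        proof -
          have "k i \<le> e" using that by auto
          then show ?thesis using hg[of i] d[of i] spec[OF True, of i] by auto
        qed
        then show ?thesis by (auto simp: v vec_eq_iff fun_eq_iff)
      qed
      have "(\<Sum>k\<in>?K. (?B k * Poly_Mapping.lookup p v when
          ((\<chi> i. k i, \<chi> i. e - k i) + v = (h, g)))) =
        (\<Sum>k\<in>?K. if k = (\<lambda>i. h $ i - a $ i) then ?B k * Poly_Mapping.lookup p v else 0)"
        by (intro sum.cong) (auto simp: iff when_def)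
      also have "\<dots> = ?B (\<lambda>i. h $ i - a $ i) * Poly_Mapping.lookup p v"
        using inK by (subst sum.delta) (auto intro: finite_PiE)
      finally show ?thesis using True by (simp add: v)
    next
      case False
      then obtain i where i: "\<not> (a $ i \<le> h $ i \<and> b $ i \<le> g $ i)" by auto
      have "(\<chi> i. k i, \<chi> i. e - k i) + v \<noteq> (h, g)" for k
      proof
        assume "(\<chi> i. k i, \<chi> i. e - k i) + v = (h, g)"
        then have "k i + a $ i = h $ i" "(e - k i) + b $ i = g $ i"
          by (auto simp: v vec_eq_iff)
        with i show False by auto
      qed
      then have "(\<Sum>k\<in>?K. (?B k * Poly_Mapping.lookup p v when
          ((\<chi> i. k i, \<chi> i. e - k i) + v = (h, g)))) = 0"
        by simp
      moreover have "(\<Prod>i\<in>UNIV. if fst v $ i \<le> h $ i \<and> snd v $ i \<le> g $ i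
          then real (e choose (h $ i - fst v $ i)) else 0) = 0"
        using i by (intro prod_zero) (auto simp: v)
      ultimately show ?thesis by (simp only: mult_zero_left)
    qed
  qed
  finally show ?thesis by (simp add: case_prod_beta)
qed

text \<open>
  This is \<open>eval_matpoly\<close> with powers replaced by falling powers. Each index \<open>i\<close> has its own step, since
  the normalization by \<open>d\<^sub>i + e\<close> differs between the indices.
\<close>

definition falling_eval ::
  "nat ^ 'n \<Rightarrow> ('n::finite, 'm::finite) matpoly \<Rightarrow> real ^ 'n \<Rightarrow> real ^ 'n \<Rightarrow> real ^ 'n \<Rightarrow> real ^ 'm ^ 'm"
  where "falling_eval d F s \<alpha> \<beta> =
    (\<Sum>(a, b) \<in> {(a, b). a + b = d}.
       (\<Prod>i\<in>UNIV. falling_power (s $ i) (\<alpha> $ i) (a $ i) * falling_power (s $ i) (\<beta> $ i) (b $ i))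
         *\<^sub>R mat_coeff F a b)"

lemma falling_eval_step_zero:
  "multi_homogeneous d F \<Longrightarrow> falling_eval d F 0 \<alpha> \<beta> = eval_matpoly F \<alpha> \<beta>"
  by (simp add: falling_eval_def eval_matpoly_multi_homogeneous falling_power_step_zero)

text \<open>
  Falling powers are homogeneous in the variable and the step jointly. Hence \<open>falling_eval\<close> inherits
  the multi-homogeneity of \<open>F\<close>, provided that the steps are scaled along with the variables.
\<close>

lemma falling_eval_scale:
  "falling_eval d F (t * s) (t * \<alpha>) (t * \<beta>) = (\<Prod>i\<in>UNIV. (t $ i) ^ (d $ i)) *\<^sub>R falling_eval d F s \<alpha> \<beta>"
  unfolding falling_eval_def scaleR_sum_right
proof (rule sum.cong[OF refl], clarify)
  fix a b assume "d = a + b"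
  show "(\<Prod>i\<in>UNIV. falling_power ((t * s) $ i) ((t * \<alpha>) $ i) (a $ i) *
            falling_power ((t * s) $ i) ((t * \<beta>) $ i) (b $ i)) *\<^sub>R mat_coeff F a b =
        (\<Prod>i\<in>UNIV. t $ i ^ (a + b) $ i) *\<^sub>R
        (\<Prod>i\<in>UNIV. falling_power (s $ i) (\<alpha> $ i) (a $ i) *
            falling_power (s $ i) (\<beta> $ i) (b $ i)) *\<^sub>R mat_coeff F a b"
    by (simp add: falling_power_scale power_add prod.distrib)
qed

lemma keys_multi_homogeneous:
  assumes "multi_homogeneous d F"
  shows "Poly_Mapping.keys (F $ j $ k) \<subseteq> {(a, b). a + b = d}"
proof clarify
  fix a b assume "(a, b) \<in> Poly_Mapping.keys (F $ j $ k)"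
  then have "mat_coeff F a b $ j $ k \<noteq> 0"
    by (simp add: mat_coeff_def map_matrix_def in_keys_iff)
  then have "mat_coeff F a b \<noteq> 0" by auto
  then show "a + b = d" using assms by (auto simp: multi_homogeneous_def)
qed

lemma mat_coeff_product:
  fixes F :: "('n::finite, 'm::finite) matpoly"
  assumes F: "multi_homogeneous d F"
    and hg: "\<And>i. h $ i + g $ i = d $ i + e"
  shows "mat_coeff (smult_matpoly (\<Prod>i\<in>UNIV. (alpha_var i + beta_var i) ^ e) F) h g =
    (\<Prod>i\<in>UNIV. fact e / (fact (h $ i) * fact (g $ i))) *\<^sub>R
      falling_eval d F 1 (\<chi> i. real (h $ i)) (\<chi> i. real (g $ i))"
proof -
  let ?D = "{(a, b). a + b = d}"
  let ?c = "\<Prod>i\<in>UNIV. fact e / (fact (h $ i) * fact (g $ i)) :: real"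
  let ?w = "\<lambda>a b. \<Prod>i\<in>UNIV. falling_power 1 (real (h $ i)) (a $ i) *
      falling_power 1 (real (g $ i)) (b $ i)"
  have binom: "(\<Prod>i\<in>UNIV. if a $ i \<le> h $ i \<and> b $ i \<le> g $ i
      then real (e choose (h $ i - a $ i)) else 0) = ?c * ?w a b" if "a + b = d" for a b
  proof -
    have "h $ i + g $ i = a $ i + b $ i + e" for i using hg[of i] that by auto
    then show ?thesis
      by (simp add: binomial_eq_falling_powers prod.distrib[symmetric])
  qed
  have "mat_coeff (smult_matpoly (\<Prod>i\<in>UNIV. (alpha_var i + beta_var i) ^ e) F) h g $ j $ k =
    (?c *\<^sub>R falling_eval d F 1 (\<chi> i. real (h $ i)) (\<chi> i. real (g $ i))) $ j $ k" for j k
  proof -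
    have "mat_coeff (smult_matpoly (\<Prod>i\<in>UNIV. (alpha_var i + beta_var i) ^ e) F) h g $ j $ k =
      (\<Sum>(a, b)\<in>?D. ?c * ?w a b * Poly_Mapping.lookup (F $ j $ k) (a, b))"
      by (simp add: mat_coeff_def smult_matpoly_def map_matrix_def
          lookup_prod_times[OF keys_multi_homogeneous[OF F] hg])
        (auto intro!: sum.cong simp: binom)
    then show ?thesis
      by (simp add: falling_eval_def mat_coeff_def map_matrix_def sum_distrib_left
          case_prod_beta mult.assoc)
  qed
  then show ?thesis by (simp add: vec_eq_iff)
qed

section \<open>Positive definiteness for small steps\<close>

lemma symmetric_mat_scaleR: "symmetric_mat A \<Longrightarrow> symmetric_mat (c *\<^sub>R A)"
  by (simp add: symmetric_mat_def transpose_def vec_eq_iff)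

lemma symmetric_mat_sum: "(\<And>v. v \<in> D \<Longrightarrow> symmetric_mat (f v)) \<Longrightarrow> symmetric_mat (\<Sum>v\<in>D. f v)"
  by (simp add: symmetric_mat_def transpose_def vec_eq_iff)

lemma pos_def_scaleR: "0 < c \<Longrightarrow> pos_def A \<Longrightarrow> pos_def (c *\<^sub>R A)"
  by (simp add: pos_def_def symmetric_mat_scaleR scaleR_matrix_vector_assoc[symmetric])

lemma pos_def_if_pos_on_sphere:
  assumes "symmetric_mat A" and pos: "\<And>x. norm x = 1 \<Longrightarrow> 0 < x \<bullet> (A *v x)"
  shows "pos_def A"
  unfolding pos_def_def
proof (intro conjI allI impI)
  fix x :: "real ^ 'a" assume "x \<noteq> 0"
  define u where "u = x /\<^sub>R norm x"
  have x: "x = norm x *\<^sub>R u" and "norm u = 1" using \<open>x \<noteq> 0\<close> by (auto simp: u_def)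
  have "x \<bullet> (A *v x) = (norm x)\<^sup>2 * (u \<bullet> (A *v u))"
    by (subst (1 2) x) (simp add: matrix_vector_mult_scaleR power2_eq_square)
  then show "0 < x \<bullet> (A *v x)"
    using pos[OF \<open>norm u = 1\<close>] \<open>x \<noteq> 0\<close> by simp
qed fact

lemma falling_eval_symmetric:
  assumes "multi_homogeneous d F" shows "symmetric_mat (falling_eval d F s \<alpha> \<beta>)"
  using assms unfolding falling_eval_def multi_homogeneous_def
  by (auto intro!: symmetric_mat_sum symmetric_mat_scaleR)

lemma continuous_on_falling_eval_form:
  "continuous_on UNIV (\<lambda>((\<alpha>, x), s). x \<bullet> (falling_eval d F s \<alpha> (1 - \<alpha>) *v x))"
proof -
  have "continuous_on UNIV (\<lambda>z. falling_eval d F (snd z) (fst (fst z)) (1 - fst (fst z)))"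
    unfolding falling_eval_def falling_power_def case_prod_beta
    by (intro continuous_intros)
  then show ?thesis
    unfolding case_prod_beta matrix_vector_mult_def
    by (intro continuous_intros)
qed

text \<open>
  The triples (point, unit vector, step) at which the form fails to be positive make up a compact set,
  once the step is confined to the unit ball. By hypothesis none of them has step \<open>0\<close>, so their steps
  stay away from \<open>0\<close>. The simplices are parametrized by \<open>\<beta> = 1 - \<alpha>\<close> with \<open>\<alpha>\<close> in the unit cube.
\<close>

lemma falling_eval_pos_def_small_step:
  fixes F :: "('n::finite, 'm::finite) matpoly"
  assumes F: "multi_homogeneous d F"
    and pos: "\<And>\<alpha> \<beta> :: real ^ 'n. (\<forall>i. (\<alpha> $ i, \<beta> $ i) \<in> unit_simplex2) \<Longrightarrow> pos_def (eval_matpoly F \<alpha> \<beta>)"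
  obtains \<delta> where "\<delta> > 0"
    "\<And>s \<alpha>. norm s < \<delta> \<Longrightarrow> (\<And>i. 0 \<le> \<alpha> $ i \<and> \<alpha> $ i \<le> 1) \<Longrightarrow> pos_def (falling_eval d F s \<alpha> (1 - \<alpha>))"
proof -
  define \<Phi> where "\<Phi> = (\<lambda>((\<alpha>, x), s). x \<bullet> (falling_eval d F s \<alpha> (1 - \<alpha>) *v x))"
  define K :: "((real ^ 'n) \<times> (real ^ 'm)) set" where "K = cbox 0 1 \<times> sphere 0 1"
  define C where "C = (K \<times> cball 0 1) \<inter> \<Phi> -` {..0}"
  have "compact C"
    unfolding C_def
  proof (rule compact_Int_closed)
    show "compact (K \<times> (cball 0 1 :: (real ^ 'n) set))"
      unfolding K_def by (intro compact_Times compact_cbox compact_sphere compact_cball)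
    show "closed (\<Phi> -` {..0})"
      using continuous_on_falling_eval_form[of d F] unfolding \<Phi>_def
      by (intro closed_vimage) auto
  qed
  then have "compact (snd ` C)"
    by (intro compact_continuous_image continuous_intros)
  moreover have "0 \<notin> snd ` C"
  proof
    assume "0 \<in> snd ` C"
    then obtain \<alpha> x where "((\<alpha>, x), 0) \<in> C" by force
    then have \<alpha>: "\<alpha> \<in> cbox 0 1" and x: "norm x = 1" and le: "\<Phi> ((\<alpha>, x), 0) \<le> 0"
      by (auto simp: C_def K_def)
    have "pos_def (eval_matpoly F \<alpha> (1 - \<alpha>))"
      using \<alpha> by (intro pos) (auto simp: unit_simplex2_def mem_box_cart)
    moreover have "x \<noteq> 0" using x by auto
    ultimately have "0 < \<Phi> ((\<alpha>, x), 0)"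
      by (simp add: \<Phi>_def falling_eval_step_zero[OF F] pos_def_def)
    with le show False by simp
  qed
  ultimately obtain \<epsilon> where "\<epsilon> > 0" and \<epsilon>: "\<And>s. s \<in> snd ` C \<Longrightarrow> \<epsilon> \<le> norm s"
    using separate_point_closed[OF compact_imp_closed, of "snd ` C" 0] by (auto simp: dist_norm)
  show thesis
  proof
    show "min \<epsilon> 1 > 0" using \<open>\<epsilon> > 0\<close> by simp
    fix s \<alpha> :: "real ^ 'n"
    assume s: "norm s < min \<epsilon> 1" and \<alpha>: "\<And>i. 0 \<le> \<alpha> $ i \<and> \<alpha> $ i \<le> 1"
    show "pos_def (falling_eval d F s \<alpha> (1 - \<alpha>))"
    proof (rule pos_def_if_pos_on_sphere[OF falling_eval_symmetric[OF F]])
      fix x :: "real ^ 'm" assume "norm x = 1"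
      show "0 < x \<bullet> (falling_eval d F s \<alpha> (1 - \<alpha>) *v x)"
      proof (rule ccontr)
        assume "\<not> ?thesis"
        then have "((\<alpha>, x), s) \<in> C"
          using s \<alpha> \<open>norm x = 1\<close> by (auto simp: C_def K_def \<Phi>_def mem_box_cart)
        then have "s \<in> snd ` C" by force
        with \<epsilon> s show False by fastforce
      qed
    qed
  qed
qed

section \<open>Positive definiteness of the coefficients\<close>

theorem theorem16:
  fixes F :: "('n::finite, 'm::finite) matpoly" and d :: "nat ^ 'n"
  assumes "multi_homogeneous d F"
    and "\<And>\<alpha> \<beta> :: real ^ 'n. (\<forall>i. (\<alpha> $ i, \<beta> $ i) \<in> unit_simplex2) \<Longrightarrow> pos_def (eval_matpoly F \<alpha> \<beta>)"
  shows "\<exists>e :: nat. \<forall>h g :: nat ^ 'n. (\<forall>i. h $ i + g $ i = d $ i + e) \<longrightarrow>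
           pos_def (mat_coeff
             (smult_matpoly (\<Prod>i\<in>UNIV. (alpha_var i + beta_var i) ^ e) F) h g)"
proof -
  obtain \<delta> where "\<delta> > 0" and \<delta>: "\<And>s \<alpha>. norm s < \<delta> \<Longrightarrow> (\<And>i. 0 \<le> \<alpha> $ i \<and> \<alpha> $ i \<le> 1) \<Longrightarrow>
      pos_def (falling_eval d F s \<alpha> (1 - \<alpha>))"
    using falling_eval_pos_def_small_step[OF assms] by blast
  \<comment> \<open>Each step is at most \<open>1 / e\<close>, so the vector of steps has norm at most \<open>CARD('n) / e\<close>.\<close>
  obtain e :: nat where e: "real CARD('n) / \<delta> < real e"
    using reals_Archimedean2 by blast
  have "0 < real CARD('n) / \<delta>" using \<open>\<delta> > 0\<close> by simp
  then have "e > 0" using e by linarith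
  show ?thesis
  proof (intro exI[of _ e] allI impI)
    fix h g :: "nat ^ 'n" assume hg: "\<forall>i. h $ i + g $ i = d $ i + e"
    define t s \<alpha> :: "real ^ 'n" where "t = (\<chi> i. real (d $ i + e))"
      and "s = (\<chi> i. 1 / real (d $ i + e))" and "\<alpha> = (\<chi> i. real (h $ i) / real (d $ i + e))"
    have ne: "real (d $ i) + real e \<noteq> 0" for i using \<open>e > 0\<close> by linarith
    have hgr: "real (h $ i) + real (g $ i) = real (d $ i) + real e" for i
      using hg by (metis of_nat_add)
    have "norm s \<le> (\<Sum>i\<in>UNIV. \<bar>s $ i\<bar>)" by (rule norm_le_l1_cart)
    also have "\<dots> \<le> (\<Sum>i\<in>(UNIV :: 'n set). 1 / real e)"
      using \<open>e > 0\<close> by (intro sum_mono) (auto simp: s_def field_simps)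
    also have "\<dots> < \<delta>" using e \<open>\<delta> > 0\<close> \<open>e > 0\<close> by (simp add: field_simps)
    finally have s: "norm s < \<delta>" .
    have "0 \<le> \<alpha> $ i \<and> \<alpha> $ i \<le> 1" for i
      using hgr[of i] \<open>e > 0\<close> by (simp add: \<alpha>_def field_simps)
    then have pd: "pos_def (falling_eval d F s \<alpha> (1 - \<alpha>))" by (rule \<delta>[OF s])
    have one: "1 = t * s" using ne by (simp add: vec_eq_iff t_def s_def)
    have th: "(\<chi> i. real (h $ i)) = t * \<alpha>" using ne by (simp add: vec_eq_iff t_def \<alpha>_def)
    have tg: "(\<chi> i. real (g $ i)) = t * (1 - \<alpha>)"
    proof -
      have "real (g $ i) = real (d $ i) + real e - real (h $ i)" for i using hgr[of i] by linarith
      then show ?thesis using ne by (simp add: vec_eq_iff t_def \<alpha>_def right_diff_distrib)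
    qed
    have "mat_coeff (smult_matpoly (\<Prod>i\<in>UNIV. (alpha_var i + beta_var i) ^ e) F) h g =
        (\<Prod>i\<in>UNIV. fact e / (fact (h $ i) * fact (g $ i))) *\<^sub>R
          (\<Prod>i\<in>UNIV. (t $ i) ^ (d $ i)) *\<^sub>R falling_eval d F s \<alpha> (1 - \<alpha>)"
      unfolding mat_coeff_product[OF assms(1) spec[OF hg]] one th tg falling_eval_scale ..
    moreover have "0 < t $ i" for i using \<open>e > 0\<close> by (simp add: t_def)
    ultimately show "pos_def (mat_coeff
        (smult_matpoly (\<Prod>i\<in>UNIV. (alpha_var i + beta_var i) ^ e) F) h g)"
      using pd by (simp add: pos_def_scaleR prod_pos)
  qed
qed

end
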